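(* Every finitely separable completely normal lattice has a monotone deviation.
   Context: A lattice $D$ is completely normal if it is distributive, has a least element $0$, and for all $a,b\in D$ there are $x,y\in D$ with $a\vee b=a\vee y=x\vee b$ and $x\wedge y=0$. A deviation on a distributive lattice $D$ with $0$ is a binary operation $\smallsetminus$ on $D$ such that $x\leq y\vee(x\smallsetminus y)$ and $(x\smallsetminus y)\wedge(y\smallsetminus x)=0$ for all $x,y\in D$. It is monotone if $x\leq x'$ implies $x\smallsetminus y\leq x'\smallsetminus y$ and $y\leq y'$ implies $x\smallsetminus y'\leq x\smallsetminus y$, for all $x,x',y,y'\in D$. A poset $M$ is finitely separable if there are functions $A$, $B$ with domain $M$ such that each $A(z)$ is a finite set of upper bounds of $z$, each $B(z)$ is a finite set of lower bounds of $z$, and for all $x,y\in M$, $x\leq y$ implies $A(x)\cap B(y)\neq\varnothing$ (a lattice is finitely separable if it is so as a poset). *)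

theory Defs
  imports Main
begin

class completely_normal_lattice = distrib_lattice + order_bot +
  assumes completely_normal:
    "\<exists>x y. sup a b = sup a y \<and> sup a b = sup x b \<and> inf x y = bot"

definition deviation :: "('a :: {distrib_lattice, order_bot} \<Rightarrow> 'a \<Rightarrow> 'a) \<Rightarrow> bool" where
  "deviation d \<longleftrightarrow>
     (\<forall>x y. x \<le> sup y (d x y)) \<and>
     (\<forall>x y. inf (d x y) (d y x) = bot)"

definition monotone_deviation :: "('a :: {distrib_lattice, order_bot} \<Rightarrow> 'a \<Rightarrow> 'a) \<Rightarrow> bool" where
  "monotone_deviation d \<longleftrightarrow>
     deviation d \<and>
     (\<forall>x x' y. x \<le> x' \<longrightarrow> d x y \<le> d x' y) \<and>
     (\<forall>x y y'. y \<le> y' \<longrightarrow> d x y' \<le> d x y)"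

(* The poset is the set M with the induced order; bounds are taken within M. *)
definition finitely_separable :: "'a :: order set \<Rightarrow> bool" where
  "finitely_separable M \<longleftrightarrow>
     (\<exists>A B. (\<forall>z\<in>M. finite (A z) \<and> A z \<subseteq> {u \<in> M. z \<le> u}) \<and>
            (\<forall>z\<in>M. finite (B z) \<and> B z \<subseteq> {u \<in> M. u \<le> z}) \<and>
            (\<forall>x\<in>M. \<forall>y\<in>M. x \<le> y \<longrightarrow> A x \<inter> B y \<noteq> {}))"

end

theory Submission
  imports Defs "HOL-Library.Countable_Set"
begin

text \<open>
  Order \<open>D \<times> D\<close> by \<open>(x, y) \<le> (x', y')\<close> iff \<open>x \<le> x'\<close> and \<open>y' \<le> y\<close>; a monotone deviation is then an
  isotone map satisfying two conditions that link each pair with its swap. Suppose such a map \<open>f\<close> is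
  defined on a swap-closed set \<open>T\<close> in which the elements above any given pair have a finite
  coinitial subset. It extends to a new pair \<open>(x, y)\<close> together with \<open>(y, x)\<close>: take \<open>d\<close>, \<open>d'\<close> from
  complete normality of \<open>x, y\<close>, join them with the values of \<open>f\<close> from below and meet the results with
  the values of \<open>f\<close> from above. Distributivity keeps the two new values disjoint, because the
  lower values at \<open>(x, y)\<close> are disjoint from the upper values at \<open>(y, x)\<close>. Finite separability makes
  every set closed under the functions \<open>A\<close>, \<open>B\<close> (and under swap) admissible as \<open>T\<close>, and it remains so
  after adding finitely many pairs. Since closures of single pairs are countable, a maximal \<open>f\<close> with
  closed domain (Zorn) is total: otherwise it could be extended along an enumeration of the closure of
  a missing pair.
\<close>

section \<open>Isotone partial maps on pairs and finite coinitial sets\<close>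

definition pair_le :: "'a::order \<times> 'a \<Rightarrow> 'a \<times> 'a \<Rightarrow> bool" where
  "pair_le p q \<longleftrightarrow> fst p \<le> fst q \<and> snd q \<le> snd p"

lemma pair_le_swap_right: "pair_le p (prod.swap q) \<longleftrightarrow> pair_le q (prod.swap p)"
  unfolding pair_le_def by auto

text \<open>Isotonicity makes these relations single-valued. All conditions but the closure of the domain
  under swap concern at most two elements of \<open>G\<close>, so they pass to unions of chains.\<close>

definition partial_deviation ::
  "(('a::{distrib_lattice, order_bot} \<times> 'a) \<times> 'a) set \<Rightarrow> bool" where
  "partial_deviation G \<longleftrightarrow>
     (\<forall>p\<in>Domain G. prod.swap p \<in> Domain G) \<and>
     (\<forall>x y z. ((x, y), z) \<in> G \<longrightarrow> x \<le> sup y z) \<and>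
     (\<forall>x y z. ((x, y), z) \<in> G \<longrightarrow> x \<le> y \<longrightarrow> z = bot) \<and>
     (\<forall>p z w. (p, z) \<in> G \<longrightarrow> (prod.swap p, w) \<in> G \<longrightarrow> inf z w = bot) \<and>
     (\<forall>p q z w. (p, z) \<in> G \<longrightarrow> (q, w) \<in> G \<longrightarrow> pair_le p q \<longrightarrow> z \<le> w)"

lemma partial_deviationD:
  assumes "partial_deviation G"
  shows "p \<in> Domain G \<Longrightarrow> prod.swap p \<in> Domain G"
    and "((x, y), z) \<in> G \<Longrightarrow> x \<le> sup y z"
    and "((x, y), z) \<in> G \<Longrightarrow> x \<le> y \<Longrightarrow> z = bot"
    and "(p, z) \<in> G \<Longrightarrow> (prod.swap p, w) \<in> G \<Longrightarrow> inf z w = bot"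
    and "(p, z) \<in> G \<Longrightarrow> (q, w) \<in> G \<Longrightarrow> pair_le p q \<Longrightarrow> z \<le> w"
  using assms unfolding partial_deviation_def by - (elim conjE, meson)+

text \<open>Only the part above \<open>q\<close> is considered: swap reverses
  \<open>pair_le\<close>, so on a swap-closed \<open>T\<close> the condition at
  \<open>prod.swap q\<close> yields a finite cofinal set below \<open>q\<close>. The pair
  \<open>q\<close> may lie outside \<open>T\<close>, as the pairs to be added do.\<close>

definition finitely_coinitial :: "('a::order \<times> 'a) set \<Rightarrow> bool" where
  "finitely_coinitial T \<longleftrightarrow>
     (\<forall>q. \<exists>U\<subseteq>T. finite U \<and> (\<forall>u\<in>U. pair_le q u) \<and>
        (\<forall>p\<in>T. pair_le q p \<longrightarrow> (\<exists>u\<in>U. pair_le u p)))"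

lemma finitely_coinitialE:
  assumes "finitely_coinitial T"
  obtains U where "U \<subseteq> T" "finite U" "\<And>u. u \<in> U \<Longrightarrow> pair_le q u"
    "\<And>p. p \<in> T \<Longrightarrow> pair_le q p \<Longrightarrow> \<exists>u\<in>U. pair_le u p"
  using assms[unfolded finitely_coinitial_def, THEN spec, of q] that by (elim exE conjE) metis

text \<open>The members of \<open>F\<close> above \<open>q\<close> serve as their own lower bounds,
  so they are simply adjoined to \<open>U\<close>.\<close>

lemma finitely_coinitial_Un_finite:
  assumes "finitely_coinitial T" "finite F"
  shows "finitely_coinitial (T \<union> F)"
  unfolding finitely_coinitial_def
proof
  fix q
  obtain U where U: "U \<subseteq> T" "finite U" "\<And>u. u \<in> U \<Longrightarrow> pair_le q u"
    "\<And>p. p \<in> T \<Longrightarrow> pair_le q p \<Longrightarrow> \<exists>u\<in>U. pair_le u p"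
    using assms(1) by (rule finitely_coinitialE[of _ q]) blast
  let ?V = "U \<union> {p \<in> F. pair_le q p}"
  have "\<exists>u\<in>?V. pair_le u p" if "p \<in> T \<union> F" "pair_le q p" for p
  proof (cases "p \<in> T")
    case True
    then show ?thesis using U(4) that(2) by blast
  next
    case False
    then have "p \<in> ?V" using that by blast
    moreover have "pair_le p p" by (simp add: pair_le_def)
    ultimately show ?thesis by (rule rev_bexI)
  qed
  moreover have "?V \<subseteq> T \<union> F" "finite ?V" "\<forall>u\<in>?V. pair_le q u"
    using U(1-3) assms(2) by auto
  ultimately show "\<exists>U\<subseteq>T \<union> F. finite U \<and> (\<forall>u\<in>U. pair_le q u) \<and>
      (\<forall>p\<in>T \<union> F. pair_le q p \<longrightarrow> (\<exists>u\<in>U. pair_le u p))"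
    by (intro exI[of _ ?V]) blast
qed

section \<open>Finite joins and relative finite meets\<close>

text \<open>Induction from \<open>bot\<close>; by distributivity, an element disjoint from
  \<open>a\<close> and \<open>j\<close> is disjoint from \<open>sup a j\<close>.\<close>

lemma disjoint_lub_exists:
  fixes F :: "'a::{distrib_lattice, order_bot} set"
  assumes "finite F"
  shows "\<exists>j. (\<forall>v\<in>F. v \<le> j) \<and> (\<forall>u. (\<forall>v\<in>F. v \<le> u) \<longrightarrow> j \<le> u) \<and>
           (\<forall>w. (\<forall>v\<in>F. inf w v = bot) \<longrightarrow> inf w j = bot)"
  using assms
proof induction
  case empty
  show ?case by (intro exI[of _ bot]) (auto intro: bot_least antisym)
next
  case (insert a F)
  then obtain j where "\<forall>v\<in>F. v \<le> j" "\<forall>u. (\<forall>v\<in>F. v \<le> u) \<longrightarrow> j \<le> u"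
    "\<forall>w. (\<forall>v\<in>F. inf w v = bot) \<longrightarrow> inf w j = bot" by blast
  then show ?case
    by (intro exI[of _ "sup a j"]) (auto simp: inf_sup_distrib1 intro: le_supI2)
qed

text \<open>A greatest element is not assumed, so the meet is taken below a given \<open>j\<close>,
  which is the value for empty \<open>F\<close>. The last clause survives each step because
  \<open>sup y (inf a m)\<close> is the meet of \<open>sup y a\<close> and
  \<open>sup y m\<close>.\<close>

lemma covering_glb_exists:
  fixes j :: "'a::distrib_lattice"
  assumes "finite F"
  shows "\<exists>m\<le>j. (\<forall>u\<in>F. m \<le> u) \<and> (\<forall>w\<le>j. (\<forall>u\<in>F. w \<le> u) \<longrightarrow> w \<le> m) \<and>
           (\<forall>x y. x \<le> sup y j \<longrightarrow> (\<forall>u\<in>F. x \<le> sup y u) \<longrightarrow> x \<le> sup y m)"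
  using assms
proof induction
  case empty
  show ?case by (intro exI[of _ j]) auto
next
  case (insert a F)
  then obtain m where "m \<le> j" "\<forall>u\<in>F. m \<le> u" "\<forall>w\<le>j. (\<forall>u\<in>F. w \<le> u) \<longrightarrow> w \<le> m"
    "\<forall>x y. x \<le> sup y j \<longrightarrow> (\<forall>u\<in>F. x \<le> sup y u) \<longrightarrow> x \<le> sup y m" by blast
  then show ?case
    by (intro exI[of _ "inf a m"]) (auto simp: sup_inf_distrib1 intro: le_infI2)
qed

section \<open>Extension by one pair and its swap\<close>

text \<open>Complete normality supplies two disjoint elements; each is replaced by
  \<open>bot\<close> if the inequality it should repair already holds. This later keeps the values
  at \<open>(x, y)\<close> and \<open>(y, x)\<close> isotone when \<open>x\<close> and
  \<open>y\<close> are comparable.\<close>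

lemma disjoint_cover_exists:
  fixes x y :: "'a::completely_normal_lattice"
  obtains d d' where "x \<le> sup y d" "y \<le> sup x d'" "inf d d' = bot"
    "x \<le> y \<Longrightarrow> d = bot" "y \<le> x \<Longrightarrow> d' = bot"
proof -
  obtain u v where uv: "sup x y = sup x v" "sup x y = sup u y" "inf u v = bot"
    using completely_normal by metis
  have "x \<le> sup y u" "y \<le> sup x v"
    using uv by (metis sup.cobounded1 sup.commute)+
  moreover have "inf bot a = bot" "inf a bot = bot" for a :: 'a
    by (auto intro: antisym)
  ultimately show thesis
    using uv(3)
    by (intro that[of "if x \<le> y then bot else u" "if y \<le> x then bot else v"])
      (auto intro: le_supI1)
qed

text \<open>\<open>U'\<close> is meant to be coinitial above \<open>(y, x)\<close>, so that its swap is cofinal below \<open>(x, y)\<close>.\<close>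

lemma new_value_exists:
  fixes f :: "'a::{distrib_lattice, order_bot} \<times> 'a \<Rightarrow> 'a"
  assumes "finite U" "finite U'"
    and U: "\<And>u. u \<in> U \<Longrightarrow> u \<in> T \<and> pair_le (x, y) u"
    and U': "\<And>u. u \<in> U' \<Longrightarrow> u \<in> T \<and> pair_le (y, x) u"
    and swap: "\<And>p. p \<in> T \<Longrightarrow> prod.swap p \<in> T"
    and cover: "\<And>p. p \<in> T \<Longrightarrow> fst p \<le> sup (snd p) (f p)"
    and bot: "\<And>p. p \<in> T \<Longrightarrow> fst p \<le> snd p \<Longrightarrow> f p = bot"
    and mono: "\<And>p q. p \<in> T \<Longrightarrow> q \<in> T \<Longrightarrow> pair_le p q \<Longrightarrow> f p \<le> f q"
    and d: "x \<le> sup y d" "x \<le> y \<Longrightarrow> d = bot"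
  shows "\<exists>e. x \<le> sup y e \<and> (x \<le> y \<longrightarrow> e = bot) \<and>
           (\<forall>u\<in>U. e \<le> f u) \<and> (\<forall>u\<in>U'. f (prod.swap u) \<le> e) \<and>
           (\<forall>w\<le>e. inf w d = bot \<longrightarrow> (\<forall>u\<in>U'. inf w (f (prod.swap u)) = bot) \<longrightarrow> w = bot)"
proof -
  \<comment> \<open>\<open>j\<close> joins \<open>d\<close> with the values from below;
    \<open>e\<close> is then \<open>j\<close> cut down by the values from above.\<close>
  obtain j where j: "\<forall>v\<in>insert d ((f \<circ> prod.swap) ` U'). v \<le> j"
    "\<And>u. \<forall>v\<in>insert d ((f \<circ> prod.swap) ` U'). v \<le> u \<Longrightarrow> j \<le> u"
    "\<And>w. \<forall>v\<in>insert d ((f \<circ> prod.swap) ` U'). inf w v = bot \<Longrightarrow> inf w j = bot"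
    using disjoint_lub_exists[of "insert d ((f \<circ> prod.swap) ` U')"] assms(2) by auto
  obtain e where e: "e \<le> j" "\<forall>u\<in>f ` U. e \<le> u" "\<And>w. w \<le> j \<Longrightarrow> \<forall>u\<in>f ` U. w \<le> u \<Longrightarrow> w \<le> e"
    "\<And>x y. x \<le> sup y j \<Longrightarrow> \<forall>u\<in>f ` U. x \<le> sup y u \<Longrightarrow> x \<le> sup y e"
    using covering_glb_exists[of "f ` U" j] assms(1) by blast
  have "x \<le> sup y j"
    using d(1) j(1) by (meson insertI1 order_trans sup.mono order_refl)
  moreover have "x \<le> sup y (f u)" if "u \<in> U" for u
  proof -
    have "x \<le> fst u" "snd u \<le> y" "fst u \<le> sup (snd u) (f u)"
      using U[OF that] cover by (auto simp: pair_le_def)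
    then show ?thesis
      by (meson order_trans sup.mono order_refl)
  qed
  ultimately have 1: "x \<le> sup y e"
    by (intro e(4)) auto
  have 2: "e = bot" if "x \<le> y"
  proof -
    have "f (prod.swap u) = bot" if "u \<in> U'" for u
      using U'[OF that] swap \<open>x \<le> y\<close> by (intro bot) (auto simp: pair_le_def)
    then have "j \<le> bot"
      using d(2)[OF that] by (intro j(2)) auto
    then show ?thesis
      using e(1) by (metis bot.extremum_uniqueI order_trans)
  qed
  \<comment> \<open>The cut spares the lower values: \<open>prod.swap v\<close> lies below
    \<open>(x, y)\<close>, hence below every member of \<open>U\<close>, and \<open>f\<close> is
    isotone.\<close>
  have 3: "f (prod.swap v) \<le> e" if "v \<in> U'" for v
  proof (intro e(3) ballI)
    show "f (prod.swap v) \<le> j"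
      using j(1) that by auto
    fix z assume "z \<in> f ` U"
    then obtain u where u: "u \<in> U" "z = f u" by blast
    have "pair_le (prod.swap v) u"
      using U[OF u(1)] U'[OF that] by (auto simp: pair_le_def)
    then show "f (prod.swap v) \<le> z"
      using U[OF u(1)] U'[OF that] swap mono u(2) by blast
  qed
  have 4: "w = bot" if "w \<le> e" "inf w d = bot" "\<forall>u\<in>U'. inf w (f (prod.swap u)) = bot" for w
  proof -
    have "inf w j = bot"
      using that by (intro j(3)) auto
    then show ?thesis
      using that(1) e(1) by (metis inf.absorb1 order_trans)
  qed
  show ?thesis
    using 1 2 3 4 e(2) by (intro exI[of _ e]) blast
qed

lemma partial_deviation_insert:
  fixes G :: "(('a::completely_normal_lattice \<times> 'a) \<times> 'a) set"
  assumes G: "partial_deviation G" and fin: "finitely_coinitial (Domain G)"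
  shows "\<exists>G'. partial_deviation G' \<and> G \<subseteq> G' \<and> Domain G' = Domain G \<union> {q, prod.swap q}"
proof (cases "q \<in> Domain G")
  case True
  moreover from True have "prod.swap q \<in> Domain G"
    using partial_deviationD(1)[OF G] by simp
  ultimately show ?thesis
    using G by blast
next
  case False
  obtain x y where q: "q = (x, y)" by (cases q)
  define T where "T = Domain G"
  have "\<forall>p\<in>T. \<exists>z. (p, z) \<in> G"
    by (simp add: T_def Domain_iff)
  then obtain f where "\<forall>p\<in>T. (p, f p) \<in> G"
    by (rule bchoice[THEN exE])
  then have f: "(p, f p) \<in> G" if "p \<in> T" for p
    using that by (rule bspec)
  note G' = partial_deviationD[OF G]
  have swap: "prod.swap p \<in> T" if "p \<in> T" for p
    using G'(1) that unfolding T_def .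
  have cover: "fst p \<le> sup (snd p) (f p)" if "p \<in> T" for p
    using G'(2) f[OF that] by (metis prod.collapse)
  have bot: "f p = bot" if "p \<in> T" "fst p \<le> snd p" for p
    using G'(3) f[OF that(1)] that(2) by (metis prod.collapse)
  have disj: "inf (f p) (f (prod.swap p)) = bot" if "p \<in> T" for p
    using f[OF that] f[OF swap[OF that]] by (rule G'(4))
  have mono: "f p \<le> f r" if "p \<in> T" "r \<in> T" "pair_le p r" for p r
    using f[OF that(1)] f[OF that(2)] that(3) by (rule G'(5))
  have val: "z = f p" and inT: "p \<in> T" if "(p, z) \<in> G" for p z
  proof -
    show "p \<in> T" using that by (auto simp: T_def)
    then have "(p, f p) \<in> G" by (rule f)
    moreover have "pair_le p p" by (simp add: pair_le_def)
    ultimately show "z = f p" using G'(5) that by (metis order_antisym)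
  qed
  obtain U where U: "U \<subseteq> T" "finite U" "\<And>u. u \<in> U \<Longrightarrow> pair_le (x, y) u"
    "\<And>p. p \<in> T \<Longrightarrow> pair_le (x, y) p \<Longrightarrow> \<exists>u\<in>U. pair_le u p"
    using fin[folded T_def] by (rule finitely_coinitialE[of _ "(x, y)"]) blast
  obtain U' where U': "U' \<subseteq> T" "finite U'" "\<And>u. u \<in> U' \<Longrightarrow> pair_le (y, x) u"
    "\<And>p. p \<in> T \<Longrightarrow> pair_le (y, x) p \<Longrightarrow> \<exists>u\<in>U'. pair_le u p"
    using fin[folded T_def] by (rule finitely_coinitialE[of _ "(y, x)"]) blast
  obtain d d' where d: "x \<le> sup y d" "y \<le> sup x d'" "inf d d' = bot"
    "x \<le> y \<Longrightarrow> d = bot" "y \<le> x \<Longrightarrow> d' = bot"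
    by (rule disjoint_cover_exists[of x y]) blast
  have UT: "u \<in> T \<and> pair_le (x, y) u" if "u \<in> U" for u
    using U(1,3) that by blast
  have U'T: "u \<in> T \<and> pair_le (y, x) u" if "u \<in> U'" for u
    using U'(1,3) that by blast
  obtain e where e: "x \<le> sup y e" "x \<le> y \<Longrightarrow> e = bot"
    "\<And>u. u \<in> U \<Longrightarrow> e \<le> f u" "\<And>u. u \<in> U' \<Longrightarrow> f (prod.swap u) \<le> e"
    "\<And>w. w \<le> e \<Longrightarrow> inf w d = bot \<Longrightarrow> \<forall>u\<in>U'. inf w (f (prod.swap u)) = bot \<Longrightarrow> w = bot"
    using new_value_exists[of U U' T x y f d, OF U(2) U'(2) UT U'T swap cover bot mono d(1,4)]
    by blast
  obtain e' where e': "y \<le> sup x e'" "y \<le> x \<Longrightarrow> e' = bot"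
    "\<And>u. u \<in> U' \<Longrightarrow> e' \<le> f u" "\<And>u. u \<in> U \<Longrightarrow> f (prod.swap u) \<le> e'"
    "\<And>w. w \<le> e' \<Longrightarrow> inf w d' = bot \<Longrightarrow> \<forall>u\<in>U. inf w (f (prod.swap u)) = bot \<Longrightarrow> w = bot"
    using new_value_exists[of U' U T y x f d', OF U'(2) U(2) U'T UT swap cover bot mono d(2,5)]
    by blast
  have disj_mono: "inf a b = bot" if "a \<le> a'" "b \<le> b'" "inf a' b' = bot" for a b a' b' :: 'a
    using that by (metis bot.extremum_uniqueI inf_mono)
  \<comment> \<open>Values below \<open>(x, y)\<close> are disjoint from \<open>e'\<close>, since
    \<open>e'\<close> is under the values at their swaps; symmetrically for \<open>e\<close>. What
    remains is the part of \<open>inf e e'\<close> inside both \<open>d\<close> and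
    \<open>d'\<close>, which is \<open>bot\<close>.\<close>
  have new_disj: "inf e e' = bot"
  proof (rule e(5))
    show "inf (inf e e') d = bot"
    proof (rule e'(5))
      show "inf (inf (inf e e') d) d' = bot"
        using d(3) by (rule disj_mono[rotated 2]) auto
      show "\<forall>u\<in>U. inf (inf (inf e e') d) (f (prod.swap u)) = bot"
      proof
        fix u assume "u \<in> U"
        then have "e \<le> f u" "u \<in> T"
          using e(3) U(1) by blast+
        then have "inf (inf e e') d \<le> f u"
          by (intro le_infI1)
        then show "inf (inf (inf e e') d) (f (prod.swap u)) = bot"
          using order_refl disj[OF \<open>u \<in> T\<close>] by (rule disj_mono)
      qed
    qed (auto intro: le_infI1)
    show "\<forall>u\<in>U'. inf (inf e e') (f (prod.swap u)) = bot"
    proof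
      fix u assume "u \<in> U'"
      then have "e' \<le> f u" "u \<in> T"
        using e'(3) U'(1) by blast+
      then have "inf e e' \<le> f u"
        by (intro le_infI2)
      then show "inf (inf e e') (f (prod.swap u)) = bot"
        using order_refl disj[OF \<open>u \<in> T\<close>] by (rule disj_mono)
    qed
  qed auto
  have above: "e \<le> f p" if "p \<in> T" "pair_le (x, y) p" for p
    using that U(1,4) e(3) mono by (meson order_trans subsetD)
  have above': "e' \<le> f p" if "p \<in> T" "pair_le (y, x) p" for p
    using that U'(1,4) e'(3) mono by (meson order_trans subsetD)
  \<comment> \<open>Swapping moves the question to the region above \<open>(y, x)\<close>, where
    \<open>U'\<close> is coinitial.\<close>
  have below: "f p \<le> e" if p: "p \<in> T" "pair_le p (x, y)" for p
  proof -
    have "pair_le (y, x) (prod.swap p)"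
      using p(2) by (auto simp: pair_le_def)
    then obtain u where u: "u \<in> U'" "pair_le u (prod.swap p)"
      using U'(4) swap p(1) by blast
    then have "f p \<le> f (prod.swap u)"
      using p(1) U'(1) swap by (intro mono) (blast, blast, simp add: pair_le_swap_right)
    then show ?thesis
      using e(4)[OF u(1)] by (rule order_trans)
  qed
  have below': "f p \<le> e'" if p: "p \<in> T" "pair_le p (y, x)" for p
  proof -
    have "pair_le (x, y) (prod.swap p)"
      using p(2) by (auto simp: pair_le_def)
    then obtain u where u: "u \<in> U" "pair_le u (prod.swap p)"
      using U(4) swap p(1) by blast
    then have "f p \<le> f (prod.swap u)"
      using p(1) U(1) swap by (intro mono) (blast, blast, simp add: pair_le_swap_right)
    then show ?thesis
      using e'(4)[OF u(1)] by (rule order_trans)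
  qed
  have "(y, x) \<notin> T" "(x, y) \<notin> T"
    using False swap[of "(y, x)"] by (auto simp: q T_def)
  define H where "H = G \<union> {((x, y), e), ((y, x), e')}"
  have H_cases: "(p, z) \<in> G \<and> p \<in> T \<and> z = f p \<or> p = (x, y) \<and> z = e \<or> p = (y, x) \<and> z = e'"
    if "(p, z) \<in> H" for p z
  proof (cases "(p, z) \<in> G")
    case True
    then show ?thesis using val[OF True] inT[OF True] by simp
  next
    case False
    then show ?thesis using that by (simp add: H_def)
  qed
  \<comment> \<open>The hypothesis says \<open>x \<le> y\<close>, so \<open>e\<close> is
    \<open>bot\<close> by the normalization.\<close>
  have cross: "e \<le> e'" if "pair_le (x, y) (y, x)"
    using that e(2) by (auto simp: pair_le_def)
  have cross': "e' \<le> e" if "pair_le (y, x) (x, y)"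
    using that e'(2) by (auto simp: pair_le_def)
  have H_mono: "z \<le> w" if H: "(p, z) \<in> H" "(r, w) \<in> H" and le: "pair_le p r" for p r z w
    using H_cases[OF H(1)] H_cases[OF H(2)] le
    by (elim disjE conjE) (simp_all add: mono above above' below below' cross cross')
  have H_disj: "inf z w = bot" if H: "(p, z) \<in> H" "(prod.swap p, w) \<in> H" for p z w
  proof (cases "p \<in> T")
    case True
    then have "z = f p" "w = f (prod.swap p)"
      using H_cases[OF H(1)] H_cases[OF H(2)] swap[OF True] \<open>(y, x) \<notin> T\<close> \<open>(x, y) \<notin> T\<close> by auto
    then show ?thesis
      using disj[OF True] by simp
  next
    case False
    then have p: "p = (x, y) \<and> z = e \<or> p = (y, x) \<and> z = e'"
      using H_cases[OF H(1)] by blast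
    then have "prod.swap p \<notin> T"
      using \<open>(y, x) \<notin> T\<close> \<open>(x, y) \<notin> T\<close> by auto
    then have w: "prod.swap p = (x, y) \<and> w = e \<or> prod.swap p = (y, x) \<and> w = e'"
      using H_cases[OF H(2)] by blast
    \<comment> \<open>For \<open>x = y\<close> both values sit at the same pair, so each must be
      disjoint from itself; both are \<open>bot\<close>.\<close>
    show ?thesis
    proof (cases "x = y")
      case True
      then have "z = bot" "w = bot"
        using p w e(2) e'(2) by (metis order_refl)+
      then show ?thesis by simp
    next
      case False
      then have "z = e \<and> w = e' \<or> z = e' \<and> w = e"
        using p w by (metis prod.inject swap_simp)
      then show ?thesis
        using new_disj inf.commute[of e e'] by metis
    qed
  qed
  have "partial_deviation H"
    unfolding partial_deviation_def
  proof (intro conjI)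
    show "\<forall>p\<in>Domain H. prod.swap p \<in> Domain H"
      using swap by (auto simp: H_def T_def)
    show "\<forall>x y z. ((x, y), z) \<in> H \<longrightarrow> x \<le> sup y z"
      using G'(2) e(1) e'(1) by (auto simp: H_def)
    show "\<forall>x y z. ((x, y), z) \<in> H \<longrightarrow> x \<le> y \<longrightarrow> z = bot"
      using G'(3) e(2) e'(2) by (auto simp: H_def)
  qed (use H_mono H_disj in blast)+
  moreover have "Domain H = Domain G \<union> {q, prod.swap q}"
    by (auto simp: H_def q)
  ultimately show ?thesis
    by (intro exI[of _ H]) (auto simp: H_def)
qed

section \<open>Unions of chains and countable extensions\<close>

lemma partial_deviation_Union:
  assumes chain: "\<And>G H. G \<in> C \<Longrightarrow> H \<in> C \<Longrightarrow> G \<subseteq> H \<or> H \<subseteq> G"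
    and C: "\<And>G. G \<in> C \<Longrightarrow> partial_deviation G"
  shows "partial_deviation (\<Union>C)"
proof -
  have two: "\<exists>G\<in>C. s \<in> G \<and> t \<in> G" if "s \<in> \<Union>C" "t \<in> \<Union>C" for s t
    using that chain by (meson UnionE subsetD)
  note C' = partial_deviationD[OF C]
  show ?thesis
    unfolding partial_deviation_def
  proof (intro conjI)
    show "\<forall>p\<in>Domain (\<Union>C). prod.swap p \<in> Domain (\<Union>C)"
    proof
      fix p assume "p \<in> Domain (\<Union>C)"
      then obtain G where "G \<in> C" "p \<in> Domain G" by blast
      then have "prod.swap p \<in> Domain G" by (rule C'(1))
      then show "prod.swap p \<in> Domain (\<Union>C)" using \<open>G \<in> C\<close> by blast
    qed
    show "\<forall>x y z. ((x, y), z) \<in> \<Union>C \<longrightarrow> x \<le> sup y z"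
      using C'(2) by (meson UnionE)
    show "\<forall>x y z. ((x, y), z) \<in> \<Union>C \<longrightarrow> x \<le> y \<longrightarrow> z = bot"
      using C'(3) by (meson UnionE)
    show "\<forall>p z w. (p, z) \<in> \<Union>C \<longrightarrow> (prod.swap p, w) \<in> \<Union>C \<longrightarrow> inf z w = bot"
      using C'(4) two by meson
    show "\<forall>p q z w. (p, z) \<in> \<Union>C \<longrightarrow> (q, w) \<in> \<Union>C \<longrightarrow> pair_le p q \<longrightarrow> z \<le> w"
      using C'(5) two by meson
  qed
qed

text \<open>The terms of an enumeration are added one by one. Each stage enlarges the original
  domain by finitely many pairs only, so it stays finitely coinitial and the next step is possible.
  The limit is not claimed to be finitely coinitial; in the application closure of its domain
  ensures this.\<close>

lemma partial_deviation_extend_countable: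
  fixes G :: "(('a::completely_normal_lattice \<times> 'a) \<times> 'a) set"
  assumes G: "partial_deviation G" and fin: "finitely_coinitial (Domain G)"
    and C: "countable C" "prod.swap ` C \<subseteq> C"
  shows "\<exists>H. partial_deviation H \<and> G \<subseteq> H \<and> Domain H = Domain G \<union> C"
proof (cases "C = {}")
  case True
  then show ?thesis using G by blast
next
  case False
  define c where "c = from_nat_into C"
  have range_c: "range c = C"
    unfolding c_def using range_from_nat_into[OF False C(1)] .
  define P where "P n H \<longleftrightarrow> partial_deviation H \<and> finitely_coinitial (Domain H) \<and>
    G \<subseteq> H \<and> Domain H = Domain G \<union> c ` {..<n} \<union> prod.swap ` c ` {..<n}" for n H
  have "\<exists>K. \<forall>n. P n (K n) \<and> K n \<subseteq> K (Suc n)"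
  proof (rule dependent_nat_choice)
    show "\<exists>H. P 0 H"
      using G fin by (auto simp: P_def)
    fix H n assume H: "P n H"
    then obtain H' where H': "partial_deviation H'" "H \<subseteq> H'"
      "Domain H' = Domain H \<union> {c n, prod.swap (c n)}"
      using partial_deviation_insert[of H "c n"] unfolding P_def by blast
    have "finitely_coinitial (Domain H')"
      unfolding H'(3) using H by (intro finitely_coinitial_Un_finite) (auto simp: P_def)
    then have "P (Suc n) H'"
      using H H' by (auto simp: P_def lessThan_Suc)
    then show "\<exists>H'. P (Suc n) H' \<and> H \<subseteq> H'"
      using H'(2) by blast
  qed
  then obtain K where K: "\<And>n. P n (K n)" "\<And>n. K n \<subseteq> K (Suc n)" by blast
  have "K m \<subseteq> K n \<or> K n \<subseteq> K m" for m n
    using K(2) lift_Suc_mono_le[of K] by (meson nat_le_linear)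
  then have "partial_deviation (\<Union>(range K))"
    using K(1) by (intro partial_deviation_Union) (auto simp: P_def)
  moreover have "G \<subseteq> \<Union>(range K)"
    using K(1)[of 0] by (auto simp: P_def)
  moreover have "Domain (\<Union>(range K)) = Domain G \<union> C"
  proof
    have "c ` {..<n} \<subseteq> C" for n
      using range_c by blast
    moreover from this have "prod.swap ` c ` {..<n} \<subseteq> C" for n
      using C(2) by (meson image_mono order_trans)
    ultimately have "Domain (K n) \<subseteq> Domain G \<union> C" for n
      using K(1)[of n] unfolding P_def by blast
    then show "Domain (\<Union>(range K)) \<subseteq> Domain G \<union> C"
      by (simp add: Domain_Union UN_least)
    have "c n \<in> Domain (K (Suc n))" for n
      using K(1)[of "Suc n"] by (auto simp: P_def)
    then have "c n \<in> Domain (\<Union>(range K))" for n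
      by blast
    then show "Domain G \<union> C \<subseteq> Domain (\<Union>(range K))"
      using range_c \<open>G \<subseteq> \<Union>(range K)\<close> by blast
  qed
  ultimately show ?thesis by blast
qed

section \<open>Closed domains and a maximal partial deviation\<close>

text \<open>For \<open>p\<close> above \<open>q\<close>, separability interpolates in both
  coordinates. The resulting pair lies in \<open>B (fst p) \<times> A (snd p)\<close>, hence in
  \<open>T\<close>, and also in \<open>A (fst q) \<times> B (snd q)\<close>, a finite set depending
  on \<open>q\<close> alone.\<close>

lemma finitely_coinitial_closed:
  fixes A B :: "'a::order \<Rightarrow> 'a set"
  assumes A: "\<And>z. finite (A z)" "\<And>z u. u \<in> A z \<Longrightarrow> z \<le> u"
    and B: "\<And>z. finite (B z)" "\<And>z u. u \<in> B z \<Longrightarrow> u \<le> z"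
    and AB: "\<And>x y. x \<le> y \<Longrightarrow> A x \<inter> B y \<noteq> {}"
    and T: "\<And>p. p \<in> T \<Longrightarrow> B (fst p) \<times> A (snd p) \<subseteq> T"
  shows "finitely_coinitial T"
  unfolding finitely_coinitial_def
proof
  fix q
  let ?U = "A (fst q) \<times> B (snd q) \<inter> T"
  have "\<exists>u\<in>?U. pair_le u p" if p: "p \<in> T" "pair_le q p" for p
  proof -
    obtain a b where "a \<in> A (fst q)" "a \<in> B (fst p)" "b \<in> A (snd p)" "b \<in> B (snd q)"
      using AB[of "fst q" "fst p"] AB[of "snd p" "snd q"] p(2) unfolding pair_le_def by blast
    then show ?thesis
      using T[OF p(1)] A(2) B(2) by (intro bexI[of _ "(a, b)"]) (auto simp: pair_le_def)
  qed
  then show "\<exists>U\<subseteq>T. finite U \<and> (\<forall>u\<in>U. pair_le q u) \<and>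
      (\<forall>p\<in>T. pair_le q p \<longrightarrow> (\<exists>u\<in>U. pair_le u p))"
    using A B by (intro exI[of _ ?U]) (auto simp: pair_le_def)
qed

theorem theorem4p8:
  assumes "finitely_separable (UNIV :: 'a :: completely_normal_lattice set)"
  shows "\<exists>d :: 'a \<Rightarrow> 'a \<Rightarrow> 'a. monotone_deviation d"
proof -
  obtain A B :: "'a \<Rightarrow> 'a set" where bounds: "\<forall>z. finite (A z) \<and> A z \<subseteq> {u. z \<le> u}"
    "\<forall>z. finite (B z) \<and> B z \<subseteq> {u. u \<le> z}"
    and AB: "\<And>x y. x \<le> y \<Longrightarrow> A x \<inter> B y \<noteq> {}"
    using assms unfolding finitely_separable_def by (elim exE conjE) simp
  have A: "\<And>z. finite (A z)" "\<And>z u. u \<in> A z \<Longrightarrow> z \<le> u"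
    and B: "\<And>z. finite (B z)" "\<And>z u. u \<in> B z \<Longrightarrow> u \<le> z"
    using bounds by auto
  \<comment> \<open>Closure under \<open>N\<close> gives both swap-closure and the hypothesis of
    \<open>finitely_coinitial_closed\<close>.\<close>
  define N where "N p = insert (prod.swap p) (B (fst p) \<times> A (snd p))" for p
  define S where "S = {G. partial_deviation G \<and> (\<forall>p\<in>Domain G. N p \<subseteq> Domain G)}"
  have "\<exists>G\<in>S. \<forall>X\<in>S. G \<subseteq> X \<longrightarrow> X = G"
  proof (rule subset_Zorn')
    fix C assume C: "subset.chain S C"
    then have "\<And>G. G \<in> C \<Longrightarrow> G \<in> S" "\<And>G H. G \<in> C \<Longrightarrow> H \<in> C \<Longrightarrow> G \<subseteq> H \<or> H \<subseteq> G"
      unfolding subset.chain_def by blast+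
    moreover from this have "partial_deviation (\<Union>C)"
      by (intro partial_deviation_Union) (auto simp: S_def)
    ultimately show "\<Union>C \<in> S"
      unfolding S_def Domain_Union by blast
  qed
  then obtain G where "G \<in> S" and max: "\<forall>X\<in>S. G \<subseteq> X \<longrightarrow> X = G"
    by (rule bexE)
  then have G: "partial_deviation G" "\<And>p. p \<in> Domain G \<Longrightarrow> N p \<subseteq> Domain G"
    by (simp_all add: S_def)
  have total: "q \<in> Domain G" for q
  proof -
    define R where "R = {(p, r). r \<in> N p}"
    \<comment> \<open>The closure of \<open>q\<close> under \<open>N\<close> is countable because
      each \<open>N p\<close> is finite.\<close>
    define C where "C = R\<^sup>* `` {q}"
    have "finite (N p)" for p
      using A(1) B(1) by (simp add: N_def)
    then have "countable (N p)" for p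
      by (rule countable_finite)
    moreover have "R `` X = (\<Union>p\<in>X. N p)" for X
      by (auto simp: R_def)
    ultimately have "countable (R `` X)" if "countable X" for X
      using that by simp
    then have "countable C"
      unfolding C_def by (rule countable_rtrancl) simp_all
    have N_C: "N p \<subseteq> C" if "p \<in> C" for p
      using that by (auto simp: C_def R_def intro: rtrancl_into_rtrancl)
    then have "prod.swap ` C \<subseteq> C"
      by (intro image_subsetI) (simp add: N_def)
    moreover have "B (fst p) \<times> A (snd p) \<subseteq> Domain G" if "p \<in> Domain G" for p
      using G(2)[OF that] by (simp add: N_def)
    then have "finitely_coinitial (Domain G)"
      by (rule finitely_coinitial_closed[of A B, rotated -1]) (use A B AB in blast)+
    ultimately obtain H where H: "partial_deviation H" "G \<subseteq> H" "Domain H = Domain G \<union> C"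
      using partial_deviation_extend_countable[of G C] G(1) \<open>countable C\<close> by blast
    \<comment> \<open>The domain of \<open>H\<close> is a union of two sets closed under
      \<open>N\<close>, so maximality of \<open>G\<close> applies.\<close>
    then have "H \<in> S"
      using G(2) N_C unfolding S_def by blast
    then have "H = G"
      using max H(2) by simp
    moreover have "q \<in> C"
      by (simp add: C_def)
    ultimately show ?thesis
      using H(3) by blast
  qed
  then have "\<forall>p. \<exists>z. (p, z) \<in> G"
    by (simp add: Domain_iff)
  then obtain g where g: "\<forall>p. (p, g p) \<in> G"
    by (rule choice[THEN exE])
  define d where "d x y = g (x, y)" for x y
  have d: "((x, y), d x y) \<in> G" for x y
    using g by (simp add: d_def)
  have "inf (d x y) (d y x) = bot" for x y
    using partial_deviationD(4)[OF G(1) d[of x y]] d[of y x] by simp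
  moreover have "d x y \<le> d x' y'" if "x \<le> x'" "y' \<le> y" for x x' y y'
  proof -
    have "pair_le (x, y) (x', y')"
      using that by (simp add: pair_le_def)
    then show ?thesis
      using partial_deviationD(5)[OF G(1) d d] by blast
  qed
  moreover have "x \<le> sup y (d x y)" for x y
    using d by (rule partial_deviationD(2)[OF G(1)])
  ultimately have "monotone_deviation d"
    unfolding monotone_deviation_def deviation_def by blast
  then show ?thesis
    by (rule exI[of _ d])
qed

end
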